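(* i) Let $\tilde{\nabla}$ be a compatible, torsion-free connection on an $F$-manifold $(M,\circ,e)$ and $$\tilde{\mathcal{S}}:=\{\tilde{\nabla}^{V}_{X}(Y)=\tilde{\nabla}_{X}(Y)+V\circ X\circ Y,\quad V\in\mathcal{X}(M)\}$$ the associated special family. Assume that $$V\circ R^{\tilde{\nabla}}_{Z,Y}X+Y\circ R^{\tilde{\nabla}}_{V,Z}X+Z\circ R^{\tilde{\nabla}}_{Y,V}X=0,\qquad\forall X,Y,Z,V\in\mathcal{X}(M).$$ Then the same condition (with $\tilde{\nabla}$ replaced by $\tilde{\nabla}^{V_{0}}$) holds for every connection $\tilde{\nabla}^{V_{0}}$ from $\tilde{\mathcal{S}}$. ii) The involution $(M,\circ,e,\mathcal{E},\tilde{\mathcal{S}})\rightarrow(M,*,\mathcal{E},e,\mathcal{S})$, $\mathcal{S}=\mathcal{D}_{\mathcal{E}}(\tilde{\mathcal{S}})$, on the set of $F$-manifolds with eventual identities and special families of connections preserves the class of special families of connections which satisfy the curvature condition that $V\circ R^{\tilde{\nabla}}_{Z,Y}X+Y\circ R^{\tilde{\nabla}}_{V,Z}X+Z\circ R^{\tilde{\nabla}}_{Y,V}X=0$ for all $X,Y,Z,V\in\mathcal{X}(M)$ and all connections $\tilde{\nabla}$ in the family (where $\circ$ is the multiplication of the $F$-manifold on which the family is given). More precisely, if $\tilde{\nabla}\in\tilde{\mathcal{S}}$ and $\nabla\in\mathcal{S}$ are any two connections belonging, respectively, to a special family $\tilde{\mathcal{S}}$ on $(M,\circ,e)$ and to its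 dual $\mathcal{S}=\mathcal{D}_{\mathcal{E}}(\tilde{\mathcal{S}})$ on $(M,*,\mathcal{E})$, then $$V\circ R^{\tilde{\nabla}}_{Z,Y}X+Y\circ R^{\tilde{\nabla}}_{V,Z}X+Z\circ R^{\tilde{\nabla}}_{Y,V}X=0,\qquad\forall X,Y,Z,V\in\mathcal{X}(M)$$ if and only if $$V*R^{\nabla}_{Z,Y}X+Y*R^{\nabla}_{V,Z}X+Z*R^{\nabla}_{Y,V}X=0,\qquad\forall X,Y,Z,V\in\mathcal{X}(M).$$
   Context: Everything is in the smooth category; $\mathcal{X}(M)$ denotes the vector fields on the manifold $M$; $R^{\nabla}$ is the curvature of a connection $\nabla$, $R^{\nabla}_{X,Y}Z=\nabla_{X}\nabla_{Y}Z-\nabla_{Y}\nabla_{X}Z-\nabla_{[X,Y]}Z$. $F$-manifold: a triple $(M,\circ,e)$ where $M$ is a manifold and $\circ$ is a fiber-preserving commutative, associative, bilinear multiplication on $TM$ with unit field $e$, such that $L_{X\circ Y}(\circ)=X\circ L_{Y}(\circ)+Y\circ L_{X}(\circ)$ for all $X,Y\in\mathcal{X}(M)$, where $L_{Z}(\circ)(X,Y)=[Z,X\circ Y]-[Z,X]\circ Y-X\circ[Z,Y]$. Invertible vector field: $\mathcal{E}$ is invertible if there is a vector field $\mathcal{E}^{-1}$ with $\mathcal{E}\circ\mathcal{E}^{-1}=e$. Eventual identity on an $F$-manifold $(M,\circ,e)$: an invertible vector field $\mathcal{E}$ such that the multiplication $X*Y:=X\circ Y\circ\mathcal{E}^{-1}$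 (whose unit field is $\mathcal{E}$) defines an $F$-manifold $(M,*,\mathcal{E})$, called the dual $F$-manifold. Compatible connection: a connection $\nabla$ on $TM$ is compatible with a commutative, associative multiplication $\circ$ on $TM$ if $\nabla_{X}(\circ)(Y,Z):=\nabla_{X}(Y\circ Z)-\nabla_{X}(Y)\circ Z-Y\circ\nabla_{X}(Z)$ is totally symmetric in $X,Y,Z$. Special family: a family of connections $\tilde{\mathcal{S}}$ on an $F$-manifold $(M,\circ,e)$ is special if $\tilde{\mathcal{S}}=\{\tilde{\nabla}^{V},\ V\in\mathcal{X}(M)\}$ where $\tilde{\nabla}^{V}_{X}(Y):=\tilde{\nabla}_{X}(Y)+V\circ X\circ Y$ and $\tilde{\nabla}$ is torsion-free and compatible with $\circ$. Dual family: for a special family $\tilde{\mathcal{S}}$ on $(M,\circ,e)$ and an eventual identity $\mathcal{E}$, $\mathcal{D}_{\mathcal{E}}(\tilde{\mathcal{S}})=\{\nabla^{W},\ W\in\mathcal{X}(M)\}$ where $\nabla^{W}_{X}(Y)=\mathcal{E}\circ\tilde{\nabla}_{X}(\mathcal{E}^{-1}\circ Y)-\tilde{\nabla}_{\mathcal{E}^{-1}\circ Y}(\mathcal{E})\circ X+W*X*Y$ and $\tilde{\nabla}\in\tilde{\mathcal{S}}$ is any connection of the family (the result does not depend on this choice). It is a special family on $(M,*,\mathcal{E})$, and $(M,\circ,e,\mathcal{E},\tilde{\mathcal{S}})\mapsto(M,*,\mathcal{E},e,\mathcal{D}_{\mathcal{E}}(\tilde{\mathcal{S}}))$ is an involution on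 the set of $F$-manifolds with eventual identities and special families of connections. *)

theory Defs
  imports "HOL-Analysis.Analysis" "HOL-Library.Function_Algebras" "HOL-Library.FuncSet"
begin

section \<open>Smooth manifolds\<close>

text \<open>Smoothness is only used on open sets, so the unrestricted derivative \<open>at x\<close> is the
  right one. \<open>Ck_on n S f\<close>: all iterated directional derivatives of order less than \<open>n\<close> are
  differentiable on \<open>S\<close>, and those of order \<open>n\<close> are continuous.\<close>

primrec Ck_on :: "nat \<Rightarrow> 'a::real_normed_vector set \<Rightarrow> ('a \<Rightarrow> 'b::real_normed_vector) \<Rightarrow> bool"
  where
    "Ck_on 0 S f \<longleftrightarrow> continuous_on S f"
  | "Ck_on (Suc n) S f \<longleftrightarrow>
       (\<forall>x\<in>S. f differentiable (at x)) \<and> (\<forall>v. Ck_on n S (\<lambda>x. frechet_derivative f (at x) v))"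

definition smooth_on :: "'a::real_normed_vector set \<Rightarrow> ('a \<Rightarrow> 'b::real_normed_vector) \<Rightarrow> bool"
  where "smooth_on S f \<longleftrightarrow> (\<forall>n. Ck_on n S f)"

text \<open>A chart is a pair of an open set and a map that only matters on this set.  The model space
  \<open>'b\<close> is an arbitrary Euclidean space. The atlas need not be maximal.\<close>

record ('a, 'b) premanifold =
  mtop :: "'a topology"
  atlas :: "('a set \<times> ('a \<Rightarrow> 'b)) set"

abbreviation points :: "('a, 'b) premanifold \<Rightarrow> 'a set"
  where "points M \<equiv> topspace (mtop M)"

definition smooth_manifold :: "('a, 'b::euclidean_space) premanifold \<Rightarrow> bool"
  where "smooth_manifold M \<longleftrightarrow>
    Hausdorff_space (mtop M) \<and> second_countable (mtop M) \<and>
    (\<forall>(U, \<phi>)\<in>atlas M. openin (mtop M) U \<and> open (\<phi> ` U) \<and>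
       homeomorphic_map (subtopology (mtop M) U) (top_of_set (\<phi> ` U)) \<phi>) \<and>
    (\<Union>(U, \<phi>)\<in>atlas M. U) = points M \<and>
    (\<forall>(U, \<phi>)\<in>atlas M. \<forall>(V, \<psi>)\<in>atlas M. smooth_on (\<phi> ` (U \<inter> V)) (\<psi> \<circ> inv_into U \<phi>))"

text \<open>Values of a smooth function outside \<open>points M\<close> are arbitrary. Derivations do not see
  them: if \<open>f\<close> vanishes on \<open>points M\<close> and \<open>k\<close> is \<open>0\<close> on \<open>points M\<close> and \<open>1\<close> elsewhere, then
  \<open>f = f * k\<close>, and the Leibniz rule at a point of \<open>M\<close> kills \<open>f * k\<close>.\<close>

definition smooth_funs :: "('a, 'b::euclidean_space) premanifold \<Rightarrow> ('a \<Rightarrow> real) set"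
  where "smooth_funs M = {f. \<forall>(U, \<phi>)\<in>atlas M. smooth_on (\<phi> ` U) (f \<circ> inv_into U \<phi>)}"

section \<open>Tangent vectors and vector fields\<close>

text \<open>Tangent vectors at \<open>p\<close> are the derivations at \<open>p\<close> of the algebra of smooth functions.
  Addition, subtraction and zero of tangent vectors and of vector fields are the pointwise ones
  of \<^theory>\<open>HOL-Library.Function_Algebras\<close>. The value \<open>0\<close> on non-smooth functions, and
  outside \<open>points M\<close> for vector fields, makes equality in HOL the intended one.\<close>

type_synonym 'a tvec = "('a \<Rightarrow> real) \<Rightarrow> real"
type_synonym 'a vfield = "'a \<Rightarrow> 'a tvec"
type_synonym 'a tmult = "'a \<Rightarrow> 'a tvec \<Rightarrow> 'a tvec \<Rightarrow> 'a tvec"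
type_synonym 'a conn = "'a vfield \<Rightarrow> 'a vfield \<Rightarrow> 'a vfield"

definition tscale :: "real \<Rightarrow> 'a tvec \<Rightarrow> 'a tvec"
  where "tscale c v = (\<lambda>f. c * v f)"

definition vscale :: "('a \<Rightarrow> real) \<Rightarrow> 'a vfield \<Rightarrow> 'a vfield"
  where "vscale f X = (\<lambda>p. tscale (f p) (X p))"

definition tangent_space :: "('a, 'b::euclidean_space) premanifold \<Rightarrow> 'a \<Rightarrow> 'a tvec set"
  where "tangent_space M p = {v.
    (\<forall>f\<in>smooth_funs M. \<forall>g\<in>smooth_funs M. v (f + g) = v f + v g) \<and>
    (\<forall>c. \<forall>f\<in>smooth_funs M. v (\<lambda>x. c * f x) = c * v f) \<and>
    (\<forall>f\<in>smooth_funs M. \<forall>g\<in>smooth_funs M. v (f * g) = v f * g p + f p * v g) \<and>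
    (\<forall>f. f \<notin> smooth_funs M \<longrightarrow> v f = 0)}"

definition vderiv :: "'a vfield \<Rightarrow> ('a \<Rightarrow> real) \<Rightarrow> 'a \<Rightarrow> real"
  where "vderiv X f = (\<lambda>p. X p f)"

definition vfields :: "('a, 'b::euclidean_space) premanifold \<Rightarrow> 'a vfield set"
  where "vfields M = {X.
    (\<forall>p\<in>points M. X p \<in> tangent_space M p) \<and>
    (\<forall>p. p \<notin> points M \<longrightarrow> X p = 0) \<and>
    (\<forall>f\<in>smooth_funs M. vderiv X f \<in> smooth_funs M)}"

definition lie_bracket :: "'a vfield \<Rightarrow> 'a vfield \<Rightarrow> 'a vfield"
  where "lie_bracket X Y = (\<lambda>p f. X p (vderiv Y f) - Y p (vderiv X f))"

section \<open>Multiplications on the tangent bundle and \<open>F\<close>-manifolds\<close>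

definition vprod ::
    "('a, 'b::euclidean_space) premanifold \<Rightarrow> 'a tmult \<Rightarrow> 'a vfield \<Rightarrow> 'a vfield \<Rightarrow> 'a vfield"
  where "vprod M m X Y = (\<lambda>p. if p \<in> points M then m p (X p) (Y p) else 0)"

text \<open>The last clause is smoothness of the multiplication as a \<open>(2,1)\<close>-tensor field.\<close>

definition tangent_mult :: "('a, 'b::euclidean_space) premanifold \<Rightarrow> 'a tmult \<Rightarrow> bool"
  where "tangent_mult M m \<longleftrightarrow>
    m \<in> (\<Pi>\<^sub>E p\<in>points M. tangent_space M p \<rightarrow>\<^sub>E tangent_space M p \<rightarrow>\<^sub>E tangent_space M p) \<and>
    (\<forall>p\<in>points M. \<forall>u\<in>tangent_space M p. \<forall>v\<in>tangent_space M p.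
       m p u v = m p v u \<and>
       (\<forall>c. m p (tscale c u) v = tscale c (m p u v) \<and> m p u (tscale c v) = tscale c (m p u v)) \<and>
       (\<forall>w\<in>tangent_space M p.
          m p (u + v) w = m p u w + m p v w \<and>
          m p w (u + v) = m p w u + m p w v \<and>
          m p (m p u v) w = m p u (m p v w))) \<and>
    (\<forall>X\<in>vfields M. \<forall>Y\<in>vfields M. vprod M m X Y \<in> vfields M)"

definition is_unit_field ::
    "('a, 'b::euclidean_space) premanifold \<Rightarrow> 'a tmult \<Rightarrow> 'a vfield \<Rightarrow> bool"
  where "is_unit_field M m e \<longleftrightarrow>
    e \<in> vfields M \<and> (\<forall>p\<in>points M. \<forall>u\<in>tangent_space M p. m p (e p) u = u)"

text \<open>\<open>lie_mult M m Z X Y\<close> is \<open>L\<^sub>Z(\<circ>)(X, Y)\<close>.\<close>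

definition lie_mult :: "('a, 'b::euclidean_space) premanifold \<Rightarrow> 'a tmult \<Rightarrow>
    'a vfield \<Rightarrow> 'a vfield \<Rightarrow> 'a vfield \<Rightarrow> 'a vfield"
  where "lie_mult M m Z X Y =
    lie_bracket Z (vprod M m X Y) - vprod M m (lie_bracket Z X) Y - vprod M m X (lie_bracket Z Y)"

definition F_manifold ::
    "('a, 'b::euclidean_space) premanifold \<Rightarrow> 'a tmult \<Rightarrow> 'a vfield \<Rightarrow> bool"
  where "F_manifold M m e \<longleftrightarrow>
    smooth_manifold M \<and> tangent_mult M m \<and> is_unit_field M m e \<and>
    (\<forall>X\<in>vfields M. \<forall>Y\<in>vfields M. \<forall>Z\<in>vfields M. \<forall>W\<in>vfields M.
       lie_mult M m (vprod M m X Y) Z W =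
       vprod M m X (lie_mult M m Y Z W) + vprod M m Y (lie_mult M m X Z W))"

section \<open>Eventual identities\<close>

definition invertible_field ::
    "('a, 'b::euclidean_space) premanifold \<Rightarrow> 'a tmult \<Rightarrow> 'a vfield \<Rightarrow> 'a vfield \<Rightarrow> bool"
  where "invertible_field M m e X \<longleftrightarrow>
    X \<in> vfields M \<and> (\<exists>Y\<in>vfields M. vprod M m X Y = e)"

definition inv_field ::
    "('a, 'b::euclidean_space) premanifold \<Rightarrow> 'a tmult \<Rightarrow> 'a vfield \<Rightarrow> 'a vfield \<Rightarrow> 'a vfield"
  where "inv_field M m e X = (THE Y. Y \<in> vfields M \<and> vprod M m X Y = e)"

definition dual_mult ::
    "('a, 'b::euclidean_space) premanifold \<Rightarrow> 'a tmult \<Rightarrow> 'a vfield \<Rightarrow> 'a vfield \<Rightarrow> 'a tmult"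
  where "dual_mult M m e E =
    (\<lambda>p\<in>points M. \<lambda>u\<in>tangent_space M p. \<lambda>v\<in>tangent_space M p.
       m p (m p u v) (inv_field M m e E p))"

definition eventual_identity ::
    "('a, 'b::euclidean_space) premanifold \<Rightarrow> 'a tmult \<Rightarrow> 'a vfield \<Rightarrow> 'a vfield \<Rightarrow> bool"
  where "eventual_identity M m e E \<longleftrightarrow>
    invertible_field M m e E \<and> F_manifold M (dual_mult M m e E) E"

section \<open>Connections\<close>

text \<open>Connections are extensional (\<open>undefined\<close> off the vector fields of \<open>M\<close>), so that families
  of connections can be compared as sets.\<close>

definition connection :: "('a, 'b::euclidean_space) premanifold \<Rightarrow> 'a conn \<Rightarrow> bool"
  where "connection M D \<longleftrightarrow>
    D \<in> vfields M \<rightarrow>\<^sub>E vfields M \<rightarrow>\<^sub>E vfields M \<and>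
    (\<forall>X\<in>vfields M. \<forall>Y\<in>vfields M. \<forall>Z\<in>vfields M.
       D (X + Y) Z = D X Z + D Y Z \<and> D X (Y + Z) = D X Y + D X Z) \<and>
    (\<forall>f\<in>smooth_funs M. \<forall>X\<in>vfields M. \<forall>Y\<in>vfields M.
       D (vscale f X) Y = vscale f (D X Y) \<and>
       D X (vscale f Y) = vscale (vderiv X f) Y + vscale f (D X Y))"

definition torsion_free :: "('a, 'b::euclidean_space) premanifold \<Rightarrow> 'a conn \<Rightarrow> bool"
  where "torsion_free M D \<longleftrightarrow>
    (\<forall>X\<in>vfields M. \<forall>Y\<in>vfields M. D X Y - D Y X = lie_bracket X Y)"

definition curvature :: "'a conn \<Rightarrow> 'a vfield \<Rightarrow> 'a vfield \<Rightarrow> 'a vfield \<Rightarrow> 'a vfield"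
  where "curvature D X Y Z = D X (D Y Z) - D Y (D X Z) - D (lie_bracket X Y) Z"

text \<open>\<open>conn_mult M m D X Y Z\<close> is \<open>\<nabla>\<^sub>X(\<circ>)(Y, Z)\<close>.\<close>

definition conn_mult :: "('a, 'b::euclidean_space) premanifold \<Rightarrow> 'a tmult \<Rightarrow> 'a conn \<Rightarrow>
    'a vfield \<Rightarrow> 'a vfield \<Rightarrow> 'a vfield \<Rightarrow> 'a vfield"
  where "conn_mult M m D X Y Z =
    D X (vprod M m Y Z) - vprod M m (D X Y) Z - vprod M m Y (D X Z)"

text \<open>The two transpositions below generate all permutations of the three arguments.\<close>

definition compatible :: "('a, 'b::euclidean_space) premanifold \<Rightarrow> 'a tmult \<Rightarrow> 'a conn \<Rightarrow> bool"
  where "compatible M m D \<longleftrightarrow>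
    (\<forall>X\<in>vfields M. \<forall>Y\<in>vfields M. \<forall>Z\<in>vfields M.
       conn_mult M m D X Y Z = conn_mult M m D Y X Z \<and>
       conn_mult M m D X Y Z = conn_mult M m D X Z Y)"

definition shift_conn ::
    "('a, 'b::euclidean_space) premanifold \<Rightarrow> 'a tmult \<Rightarrow> 'a conn \<Rightarrow> 'a vfield \<Rightarrow> 'a conn"
  where "shift_conn M m D V =
    (\<lambda>X\<in>vfields M. \<lambda>Y\<in>vfields M. D X Y + vprod M m (vprod M m V X) Y)"

definition assoc_family ::
    "('a, 'b::euclidean_space) premanifold \<Rightarrow> 'a tmult \<Rightarrow> 'a conn \<Rightarrow> 'a conn set"
  where "assoc_family M m D = {shift_conn M m D V | V. V \<in> vfields M}"

definition special_family ::
    "('a, 'b::euclidean_space) premanifold \<Rightarrow> 'a tmult \<Rightarrow> 'a conn set \<Rightarrow> bool"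
  where "special_family M m S \<longleftrightarrow>
    (\<exists>D. connection M D \<and> torsion_free M D \<and> compatible M m D \<and> S = assoc_family M m D)"

definition curvature_condition ::
    "('a, 'b::euclidean_space) premanifold \<Rightarrow> 'a tmult \<Rightarrow> 'a conn \<Rightarrow> bool"
  where "curvature_condition M m D \<longleftrightarrow>
    (\<forall>X\<in>vfields M. \<forall>Y\<in>vfields M. \<forall>Z\<in>vfields M. \<forall>V\<in>vfields M.
       vprod M m V (curvature D Z Y X) + vprod M m Y (curvature D V Z X) +
       vprod M m Z (curvature D Y V X) = 0)"

section \<open>Duality\<close>

definition dual_conn :: "('a, 'b::euclidean_space) premanifold \<Rightarrow> 'a tmult \<Rightarrow> 'a vfield \<Rightarrow>
    'a vfield \<Rightarrow> 'a conn \<Rightarrow> 'a vfield \<Rightarrow> 'a conn"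
  where "dual_conn M m e E D W =
    (let E' = inv_field M m e E; m' = dual_mult M m e E in
     (\<lambda>X\<in>vfields M. \<lambda>Y\<in>vfields M.
       vprod M m E (D X (vprod M m E' Y)) - vprod M m (D (vprod M m E' Y) E) X
       + vprod M m' (vprod M m' W X) Y))"

text \<open>For a special family \<open>S\<close>, each single \<open>D\<close> in \<open>S\<close> already yields the whole dual family;
  ranging over all of them avoids choosing one.\<close>

definition dual_family :: "('a, 'b::euclidean_space) premanifold \<Rightarrow> 'a tmult \<Rightarrow> 'a vfield \<Rightarrow>
    'a vfield \<Rightarrow> 'a conn set \<Rightarrow> 'a conn set"
  where "dual_family M m e E S = {dual_conn M m e E D W | D W. D \<in> S \<and> W \<in> vfields M}"

type_synonym 'a F_structure = "'a tmult \<times> 'a vfield \<times> 'a vfield \<times> 'a conn set"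

definition F_structures :: "('a, 'b::euclidean_space) premanifold \<Rightarrow> 'a F_structure set"
  where "F_structures M = {(m, e, E, S).
    F_manifold M m e \<and> eventual_identity M m e E \<and> special_family M m S}"

definition curvature_F_structures :: "('a, 'b::euclidean_space) premanifold \<Rightarrow> 'a F_structure set"
  where "curvature_F_structures M =
    {(m, e, E, S) \<in> F_structures M. \<forall>D\<in>S. curvature_condition M m D}"

definition dual_structure ::
    "('a, 'b::euclidean_space) premanifold \<Rightarrow> 'a F_structure \<Rightarrow> 'a F_structure"
  where "dual_structure M = (\<lambda>(m, e, E, S).
    (dual_mult M m e E, E, e, dual_family M m e E S))"

end

theory Submission
  imports Defs
begin

text \<open>Let \<open>F = E\<^sup>-\<^sup>1\<close>. Connections of the special family and of its dual are all of the form
  \<open>D'\<^sub>X(Y) = E \<circ> (D\<^sub>X(F \<circ> Y) + X \<circ> T(F \<circ> Y))\<close> for an additive operator \<open>T\<close>: take \<open>E = F = e\<close> and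
  \<open>T y = V \<circ> y\<close> for a shift, and \<open>T y = W \<circ> F \<circ> F \<circ> y - F \<circ> D\<^sub>y E\<close> for the dual connections.
  Since \<open>D\<close> is torsion-free and compatible, the curvature of such a \<open>D'\<close> is
  \<open>R'\<^sub>Z\<^sub>,\<^sub>Y X = E \<circ> (R\<^sub>Z\<^sub>,\<^sub>Y (F \<circ> X) + Y \<circ> Q\<^sub>Z - Z \<circ> Q\<^sub>Y)\<close>, where \<open>Q\<close> depends on \<open>X\<close> only. The \<open>Q\<close>-terms
  cancel in the cyclic sum, so the cyclic sum for \<open>D'\<close> at \<open>X\<close> is \<open>E\<close> times the one for \<open>D\<close> at
  \<open>F \<circ> X\<close>. That the dual family is special follows from
  \<open>L\<^sub>E(\<circ>)(X, Y) = [e, E] \<circ> X \<circ> Y\<close>, which says that \<open>E\<close> acts as a derivation of the dual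
  multiplication.\<close>

section \<open>Smooth functions and vector fields\<close>

lemma frechet_derivative_eqI: "(f has_derivative f') (at x) \<Longrightarrow> frechet_derivative f (at x) = f'"
  by (metis frechet_derivative_at)

text \<open>At a point of an open set the derivative sees only nearby values. The inductions below
  rely on this, because the derivative of a sum or a product is given by its formula only on
  \<open>S\<close>.\<close>

lemma Ck_on_cong:
  assumes "open S" "\<And>x. x \<in> S \<Longrightarrow> f x = g x" "Ck_on n S f"
  shows "Ck_on n S g"
  using assms(2,3)
proof (induction n arbitrary: f g)
  case 0
  then show ?case using continuous_on_cong by force
next
  case (Suc n)
  have d: "(g has_derivative frechet_derivative f (at x)) (at x)" if "x \<in> S" for x
  proof -
    have "(f has_derivative frechet_derivative f (at x)) (at x)"
      using Suc.prems that frechet_derivative_works by auto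
    then show ?thesis
      using has_derivative_transform_within_open[OF _ assms(1) that] Suc.prems(1) by blast
  qed
  have "Ck_on n S (\<lambda>x. frechet_derivative g (at x) v)" for v
    by (rule Suc.IH[of "\<lambda>x. frechet_derivative f (at x) v"])
      (use Suc.prems frechet_derivative_eqI[OF d] in auto)
  then show ?case using d by (auto simp: differentiable_def)
qed

lemma Ck_on_Suc_imp: "Ck_on (Suc n) S f \<Longrightarrow> Ck_on n S f"
proof (induction n arbitrary: f)
  case 0
  then show ?case
    by (auto intro!: continuous_at_imp_continuous_on differentiable_imp_continuous_within)
next
  case (Suc n)
  then show ?case by (metis Ck_on.simps(2))
qed

lemma Ck_on_const: "Ck_on n S (\<lambda>x. c)"
  by (induction n arbitrary: c) auto

lemma Ck_on_add:
  assumes "open S" "Ck_on n S f" "Ck_on n S g"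
  shows "Ck_on n S (\<lambda>x. f x + g x)"
  using assms(2,3)
proof (induction n arbitrary: f g)
  case 0
  then show ?case by (auto intro: continuous_intros)
next
  case (Suc n)
  have d: "((\<lambda>x. f x + g x) has_derivative
      (\<lambda>v. frechet_derivative f (at x) v + frechet_derivative g (at x) v)) (at x)" if "x \<in> S" for x
    using Suc.prems that by (intro has_derivative_add) (auto simp: frechet_derivative_works)
  have "Ck_on n S (\<lambda>x. frechet_derivative (\<lambda>x. f x + g x) (at x) v)" for v
  proof (rule Ck_on_cong[OF assms(1)])
    show "Ck_on n S (\<lambda>x. frechet_derivative f (at x) v + frechet_derivative g (at x) v)"
      using Suc by auto
  qed (use frechet_derivative_eqI[OF d] in auto)
  then show ?case using d by (auto simp: differentiable_def)
qed

lemma Ck_on_mult: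
  fixes f g :: "'a::real_normed_vector \<Rightarrow> real"
  assumes "open S" "Ck_on n S f" "Ck_on n S g"
  shows "Ck_on n S (\<lambda>x. f x * g x)"
  using assms(2,3)
proof (induction n arbitrary: f g)
  case 0
  then show ?case by (auto intro: continuous_intros)
next
  case (Suc n)
  have d: "((\<lambda>x. f x * g x) has_derivative
      (\<lambda>v. f x * frechet_derivative g (at x) v + frechet_derivative f (at x) v * g x)) (at x)"
    if "x \<in> S" for x
    using Suc.prems that by (intro has_derivative_mult) (auto simp: frechet_derivative_works)
  have "Ck_on n S (\<lambda>x. frechet_derivative (\<lambda>x. f x * g x) (at x) v)" for v
  proof (rule Ck_on_cong[OF assms(1)])
    \<comment> \<open>The product rule leaves one factor undifferentiated in each summand, so the
      order of \<open>f\<close> and \<open>g\<close> has to be lowered from \<open>Suc n\<close> to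
      \<open>n\<close>.\<close>
    show "Ck_on n S (\<lambda>x. f x * frechet_derivative g (at x) v + frechet_derivative f (at x) v * g x)"
      using Suc.prems by (intro Ck_on_add Suc.IH assms(1) Ck_on_Suc_imp[of n S f]
          Ck_on_Suc_imp[of n S g]) auto
  qed (use frechet_derivative_eqI[OF d] in auto)
  then show ?case using d by (auto simp: differentiable_def)
qed

lemma smooth_funs_const: "(\<lambda>_. c) \<in> smooth_funs M"
  by (auto simp: smooth_funs_def smooth_on_def o_def Ck_on_const)

lemma chart_image_open: "smooth_manifold M \<Longrightarrow> (U, \<phi>) \<in> atlas M \<Longrightarrow> open (\<phi> ` U)"
  by (auto simp: smooth_manifold_def)

lemma smooth_funs_add:
  "smooth_manifold M \<Longrightarrow> f \<in> smooth_funs M \<Longrightarrow> g \<in> smooth_funs M \<Longrightarrow> (\<lambda>x. f x + g x) \<in> smooth_funs M"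
  by (fastforce simp: smooth_funs_def smooth_on_def o_def intro!: Ck_on_add chart_image_open)

lemma smooth_funs_mult:
  "smooth_manifold M \<Longrightarrow> f \<in> smooth_funs M \<Longrightarrow> g \<in> smooth_funs M \<Longrightarrow> (\<lambda>x. f x * g x) \<in> smooth_funs M"
  by (fastforce simp: smooth_funs_def smooth_on_def o_def intro!: Ck_on_mult chart_image_open)

section \<open>Tangent spaces and vector fields under addition and scaling\<close>

lemma vfields_tangent: "X \<in> vfields M \<Longrightarrow> p \<in> points M \<Longrightarrow> X p \<in> tangent_space M p"
  and vfields_off: "X \<in> vfields M \<Longrightarrow> p \<notin> points M \<Longrightarrow> X p = 0"
  by (auto simp: vfields_def)

lemma tangent_space_add:
  "u \<in> tangent_space M p \<Longrightarrow> v \<in> tangent_space M p \<Longrightarrow> u + v \<in> tangent_space M p"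
  by (auto simp: tangent_space_def algebra_simps)

lemma tangent_space_tscale: "u \<in> tangent_space M p \<Longrightarrow> tscale c u \<in> tangent_space M p"
  by (auto simp: tangent_space_def tscale_def algebra_simps)

lemma vfields_add:
  assumes "smooth_manifold M" "X \<in> vfields M" "Y \<in> vfields M"
  shows "X + Y \<in> vfields M"
  using assms smooth_funs_add[OF assms(1)]
  by (auto simp: vfields_def vderiv_def intro: tangent_space_add)

lemma vfields_vscale:
  assumes "smooth_manifold M" "f \<in> smooth_funs M" "X \<in> vfields M"
  shows "vscale f X \<in> vfields M"
  using assms smooth_funs_mult[OF assms(1)]
  by (auto simp: vfields_def vderiv_def vscale_def tangent_space_tscale)
    (auto simp: tscale_def fun_eq_iff)

lemma vfields_uminus:
  assumes "smooth_manifold M" "X \<in> vfields M"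
  shows "- X \<in> vfields M"
proof -
  have "- X = vscale (\<lambda>_. -1) X"
    by (auto simp: vscale_def tscale_def fun_eq_iff)
  then show ?thesis
    using vfields_vscale[OF assms(1) smooth_funs_const assms(2)] by simp
qed

section \<open>Algebras with a compatible connection\<close>

text \<open>The algebra of vector fields lives on a carrier set, but its additive structure is that of
  the ambient function type, so that only the product has to be relativised.\<close>

locale carrier_algebra =
  fixes A :: "'v::ab_group_add set" and mult :: "'v \<Rightarrow> 'v \<Rightarrow> 'v" (infixl \<open>\<odot>\<close> 70) and e :: 'v
  assumes add_closed [simp]: "X \<in> A \<Longrightarrow> Y \<in> A \<Longrightarrow> X + Y \<in> A"
    and uminus_closed [simp]: "X \<in> A \<Longrightarrow> - X \<in> A"
    and mult_closed [simp]: "X \<in> A \<Longrightarrow> Y \<in> A \<Longrightarrow> X \<odot> Y \<in> A"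
    and mult_comm: "X \<in> A \<Longrightarrow> Y \<in> A \<Longrightarrow> X \<odot> Y = Y \<odot> X"
    and mult_assoc: "X \<in> A \<Longrightarrow> Y \<in> A \<Longrightarrow> Z \<in> A \<Longrightarrow> X \<odot> Y \<odot> Z = X \<odot> (Y \<odot> Z)"
    and distrib_right: "X \<in> A \<Longrightarrow> Y \<in> A \<Longrightarrow> Z \<in> A \<Longrightarrow> (X + Y) \<odot> Z = X \<odot> Z + Y \<odot> Z"
    and unit_closed [simp]: "e \<in> A"
    and unit_left [simp]: "X \<in> A \<Longrightarrow> e \<odot> X = X"
begin

lemma zero_closed [simp]: "0 \<in> A"
  using add_closed[OF unit_closed uminus_closed[OF unit_closed]] by simp

lemma diff_closed [simp]: "X \<in> A \<Longrightarrow> Y \<in> A \<Longrightarrow> X - Y \<in> A"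
  using add_closed[of X "- Y"] by simp

lemma unit_right [simp]: "X \<in> A \<Longrightarrow> X \<odot> e = X"
  using mult_comm[of X e] by simp

lemma distrib_left: "X \<in> A \<Longrightarrow> Y \<in> A \<Longrightarrow> Z \<in> A \<Longrightarrow> Z \<odot> (X + Y) = Z \<odot> X + Z \<odot> Y"
  using distrib_right[of X Y Z] by (simp add: mult_comm)

lemma mult_zero_left [simp]: "Z \<in> A \<Longrightarrow> 0 \<odot> Z = 0"
  using distrib_right[of 0 0 Z] by simp

lemma mult_zero_right [simp]: "Z \<in> A \<Longrightarrow> Z \<odot> 0 = 0"
  using mult_comm[of Z 0] by simp

lemma minus_mult_left: "X \<in> A \<Longrightarrow> Z \<in> A \<Longrightarrow> (- X) \<odot> Z = - (X \<odot> Z)"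
  using distrib_right[of X "- X" Z] by (simp add: add_eq_0_iff)

lemma minus_mult_right: "X \<in> A \<Longrightarrow> Z \<in> A \<Longrightarrow> Z \<odot> (- X) = - (Z \<odot> X)"
  using minus_mult_left[of X Z] by (simp add: mult_comm)

lemma diff_mult_left: "X \<in> A \<Longrightarrow> Y \<in> A \<Longrightarrow> Z \<in> A \<Longrightarrow> (X - Y) \<odot> Z = X \<odot> Z - Y \<odot> Z"
  using distrib_right[of X "- Y" Z] by (simp add: minus_mult_left)

lemma diff_mult_right: "X \<in> A \<Longrightarrow> Y \<in> A \<Longrightarrow> Z \<in> A \<Longrightarrow> Z \<odot> (X - Y) = Z \<odot> X - Z \<odot> Y"
  using distrib_left[of X "- Y" Z] by (simp add: minus_mult_right)

lemma mult_left_comm: "X \<in> A \<Longrightarrow> Y \<in> A \<Longrightarrow> Z \<in> A \<Longrightarrow> X \<odot> (Y \<odot> Z) = Y \<odot> (X \<odot> Z)"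
  by (metis mult_assoc mult_comm)

lemmas distribs = distrib_left distrib_right diff_mult_left diff_mult_right
  minus_mult_left minus_mult_right
lemmas ac = mult_assoc mult_comm mult_left_comm

end

section \<open>Curvature of perturbed connections\<close>

definition curv :: "('v::ab_group_add \<Rightarrow> 'v \<Rightarrow> 'v) \<Rightarrow> ('v \<Rightarrow> 'v \<Rightarrow> 'v) \<Rightarrow> 'v \<Rightarrow> 'v \<Rightarrow> 'v \<Rightarrow> 'v"
  where "curv br D X Y Z = D X (D Y Z) - D Y (D X Z) - D (br X Y) Z"

text \<open>This is the left-hand side of the curvature condition, with product and curvature as
  parameters so that it can be formed for both multiplications and for every connection.\<close>

definition cyclic_sum ::
    "('v::ab_group_add \<Rightarrow> 'v \<Rightarrow> 'v) \<Rightarrow> ('v \<Rightarrow> 'v \<Rightarrow> 'v \<Rightarrow> 'v) \<Rightarrow> 'v \<Rightarrow> 'v \<Rightarrow> 'v \<Rightarrow> 'v \<Rightarrow> 'v"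
  where "cyclic_sum mul R X Y Z V = mul V (R Z Y X) + mul Y (R V Z X) + mul Z (R Y V X)"

text \<open>Torsion-freeness is stored as a formula for the bracket, which turns bracket identities
  into identities of covariant derivatives. \<open>compat_swap\<close> exchanges the first two
  arguments; with commutativity, which exchanges the last two, total symmetry follows.\<close>

locale compatible_algebra = carrier_algebra A mult e
  for A :: "'v::ab_group_add set" and mult (infixl \<open>\<odot>\<close> 70) and e +
  fixes br D :: "'v \<Rightarrow> 'v \<Rightarrow> 'v"
  assumes D_closed [simp]: "X \<in> A \<Longrightarrow> Y \<in> A \<Longrightarrow> D X Y \<in> A"
    and D_add_left: "X \<in> A \<Longrightarrow> Y \<in> A \<Longrightarrow> Z \<in> A \<Longrightarrow> D (X + Y) Z = D X Z + D Y Z"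
    and D_add_right: "X \<in> A \<Longrightarrow> Y \<in> A \<Longrightarrow> Z \<in> A \<Longrightarrow> D X (Y + Z) = D X Y + D X Z"
    and br_eq: "X \<in> A \<Longrightarrow> Y \<in> A \<Longrightarrow> br X Y = D X Y - D Y X"
    and compat_swap: "X \<in> A \<Longrightarrow> Y \<in> A \<Longrightarrow> Z \<in> A \<Longrightarrow>
      D X (Y \<odot> Z) - D X Y \<odot> Z - Y \<odot> D X Z = D Y (X \<odot> Z) - D Y X \<odot> Z - X \<odot> D Y Z"
begin

lemma br_closed [simp]: "X \<in> A \<Longrightarrow> Y \<in> A \<Longrightarrow> br X Y \<in> A"
  by (simp add: br_eq)

text \<open>Solving compatibility for its first term; torsion-freeness merges
  \<open>D X Y - D Y X\<close> into the bracket. The direction of differentiation is traded against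
  a factor of the argument.\<close>

lemma D_mult_swap:
  assumes "X \<in> A" "Y \<in> A" "Z \<in> A"
  shows "D X (Y \<odot> Z) = D Y (X \<odot> Z) + br X Y \<odot> Z + Y \<odot> D X Z - X \<odot> D Y Z"
  using compat_swap[OF assms] assms by (simp add: br_eq distribs algebra_simps)

text \<open>The outer factor \<open>E\<close> of one application of \<open>D'\<close> cancels the
  inner \<open>F\<close> of the next, so iterating \<open>D'\<close> amounts to iterating
  \<open>D U + U \<odot> T\<close> on \<open>F \<odot> X\<close>. After antisymmetrisation every
  term other than the curvature carries a factor \<open>Y\<close> or \<open>Z\<close>, and the
  cofactors are \<open>Q Z\<close> and \<open>Q Y\<close>.\<close>

lemma curv_perturbed:
  assumes EF: "E \<in> A" "F \<in> A" "E \<odot> F = e"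
    and T: "\<And>X. X \<in> A \<Longrightarrow> T X \<in> A" "\<And>X Y. X \<in> A \<Longrightarrow> Y \<in> A \<Longrightarrow> T (X + Y) = T X + T Y"
    and D': "\<And>X Y. X \<in> A \<Longrightarrow> Y \<in> A \<Longrightarrow> D' X Y = E \<odot> (D X (F \<odot> Y) + X \<odot> T (F \<odot> Y))"
    and A: "X \<in> A" "Y \<in> A" "Z \<in> A"
  defines "Q \<equiv> \<lambda>U. D U (T (F \<odot> X)) - T (D U (F \<odot> X)) - T (U \<odot> T (F \<odot> X))"
  shows "curv br D' Z Y X = E \<odot> (curv br D Z Y (F \<odot> X) + Y \<odot> Q Z - Z \<odot> Q Y)"
proof -
  define x where "x = F \<odot> X"
  have x: "x \<in> A" by (simp add: x_def EF A)
  have FE: "F \<odot> (E \<odot> U) = U" if "U \<in> A" for U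
    using that EF by (metis mult_assoc mult_comm unit_left)
  have D'E: "D' U (E \<odot> W) = E \<odot> (D U W + U \<odot> T W)" if "U \<in> A" "W \<in> A" for U W
    using that EF by (simp add: D' FE)
  have D'x: "D' U X = E \<odot> (D U x + U \<odot> T x)" if "U \<in> A" for U
    using that A by (simp add: D' x_def)
  have D'D': "D' U (D' W X) =
      E \<odot> (D U (D W x) + D U (W \<odot> T x) + U \<odot> T (D W x) + U \<odot> T (W \<odot> T x))"
    if "U \<in> A" "W \<in> A" for U W
    using that x A EF T by (simp add: D'x D'E D_add_right) (simp add: distribs algebra_simps)
  \<comment> \<open>Compatibility frees the factor from under the derivative; the bracket term it
    creates cancels against the one in \<open>D' (br Z Y) X\<close>.\<close>
  have swap: "D Z (Y \<odot> T x) = D Y (Z \<odot> T x) + br Z Y \<odot> T x + Y \<odot> D Z (T x) - Z \<odot> D Y (T x)"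
    using A x T by (intro D_mult_swap) auto
  show ?thesis
    unfolding curv_def Q_def x_def[symmetric] D'D'[OF A(3,2)] D'D'[OF A(2,3)]
      D'x[OF br_closed[OF A(3,2)]] swap
    using A x EF T by (simp add: distribs algebra_simps)
qed

text \<open>By commutativity each triple product with \<open>Q\<close> occurs twice with opposite
  signs: \<open>V \<odot> Y \<odot> Q Z\<close>, for instance, comes from the first and from the
  second summand.\<close>

lemma cyclic_sum_perturbed:
  assumes EF: "E \<in> A" "F \<in> A" "E \<odot> F = e"
    and T: "\<And>X. X \<in> A \<Longrightarrow> T X \<in> A" "\<And>X Y. X \<in> A \<Longrightarrow> Y \<in> A \<Longrightarrow> T (X + Y) = T X + T Y"
    and D': "\<And>X Y. X \<in> A \<Longrightarrow> Y \<in> A \<Longrightarrow> D' X Y = E \<odot> (D X (F \<odot> Y) + X \<odot> T (F \<odot> Y))"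
    and A: "X \<in> A" "Y \<in> A" "Z \<in> A" "V \<in> A"
  shows "cyclic_sum (\<odot>) (curv br D') X Y Z V = E \<odot> cyclic_sum (\<odot>) (curv br D) (F \<odot> X) Y Z V"
proof -
  define Q where "Q U = D U (T (F \<odot> X)) - T (D U (F \<odot> X)) - T (U \<odot> T (F \<odot> X))" for U
  have Q: "Q U \<in> A" if "U \<in> A" for U
    using that A EF T by (simp add: Q_def)
  define x where "x = F \<odot> X"
  have x: "x \<in> A" by (simp add: x_def EF A)
  have c: "curv br D U W x \<in> A" if "U \<in> A" "W \<in> A" for U W
    using that x by (simp add: curv_def)
  have *: "curv br D' U W X = E \<odot> (curv br D U W x + W \<odot> Q U - U \<odot> Q W)"
    if "U \<in> A" "W \<in> A" for U W
    unfolding Q_def x_def using curv_perturbed[OF EF T D' A(1) that(2,1)] by simp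
  show ?thesis
    unfolding cyclic_sum_def x_def[symmetric]
    using A x EF Q c by (simp add: * distribs ac)
qed

text \<open>Since \<open>E\<close> and \<open>F\<close> are inverse to each other,
  \<open>F \<odot> X\<close> ranges over all of \<open>A\<close> as \<open>X\<close> does, and the
  outer factor \<open>E\<close> can be cancelled.\<close>

lemma cyclic_sum_perturbed_iff:
  assumes EF: "E \<in> A" "F \<in> A" "E \<odot> F = e"
    and T: "\<And>X. X \<in> A \<Longrightarrow> T X \<in> A" "\<And>X Y. X \<in> A \<Longrightarrow> Y \<in> A \<Longrightarrow> T (X + Y) = T X + T Y"
    and D': "\<And>X Y. X \<in> A \<Longrightarrow> Y \<in> A \<Longrightarrow> D' X Y = E \<odot> (D X (F \<odot> Y) + X \<odot> T (F \<odot> Y))"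
  shows "(\<forall>X\<in>A. \<forall>Y\<in>A. \<forall>Z\<in>A. \<forall>V\<in>A. cyclic_sum (\<odot>) (curv br D') X Y Z V = 0) \<longleftrightarrow>
    (\<forall>X\<in>A. \<forall>Y\<in>A. \<forall>Z\<in>A. \<forall>V\<in>A. cyclic_sum (\<odot>) (curv br D) X Y Z V = 0)" (is "?L \<longleftrightarrow> ?R")
proof
  note eq = cyclic_sum_perturbed[OF EF T D']
  have FE: "F \<odot> (E \<odot> U) = U" if "U \<in> A" for U
    using that EF by (metis mult_assoc mult_comm unit_left)
  show ?R if ?L
  proof (intro ballI)
    fix X Y Z V assume A: "X \<in> A" "Y \<in> A" "Z \<in> A" "V \<in> A"
    have c: "cyclic_sum (\<odot>) (curv br D) X Y Z V \<in> A"
      using A by (simp add: cyclic_sum_def curv_def)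
    have "E \<odot> cyclic_sum (\<odot>) (curv br D) X Y Z V = 0"
      using eq[of "E \<odot> X" Y Z V] that A EF by (simp add: FE)
    then show "cyclic_sum (\<odot>) (curv br D) X Y Z V = 0"
      using FE[OF c] EF by simp
  qed
  show ?L if ?R
    using that EF by (simp add: eq)
qed

text \<open>Compatibility with two arguments equal to \<open>e\<close>: the covariant derivative of
  the unit is multiplication by one fixed element.\<close>

lemma D_unit: "X \<in> A \<Longrightarrow> D X e = X \<odot> D e e"
  using D_mult_swap[of X e e] by (simp add: br_eq)

end

section \<open>Eventual identities\<close>

text \<open>\<open>br_unit\<close> says that the unit field of an F-manifold derives its product.
  \<open>br_E_dual\<close> is the same fact for the dual product, whose unit is
  \<open>E\<close>.\<close>

locale eventual_algebra = compatible_algebra A mult e br D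
  for A :: "'v::ab_group_add set" and mult (infixl \<open>\<odot>\<close> 70) and e br D +
  fixes E F :: 'v
  assumes E_closed [simp]: "E \<in> A" and F_closed [simp]: "F \<in> A" and EF [simp]: "E \<odot> F = e"
    and lie_mult: "X \<in> A \<Longrightarrow> Y \<in> A \<Longrightarrow> Z \<in> A \<Longrightarrow> W \<in> A \<Longrightarrow>
      br (X \<odot> Y) (Z \<odot> W) - br (X \<odot> Y) Z \<odot> W - Z \<odot> br (X \<odot> Y) W =
      X \<odot> (br Y (Z \<odot> W) - br Y Z \<odot> W - Z \<odot> br Y W) +
      Y \<odot> (br X (Z \<odot> W) - br X Z \<odot> W - Z \<odot> br X W)"
    and br_unit: "X \<in> A \<Longrightarrow> Y \<in> A \<Longrightarrow> br e (X \<odot> Y) = br e X \<odot> Y + X \<odot> br e Y"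
    and br_E_dual: "X \<in> A \<Longrightarrow> Y \<in> A \<Longrightarrow> br E (X \<odot> Y \<odot> F) = br E X \<odot> Y \<odot> F + X \<odot> br E Y \<odot> F"
begin

section \<open>Brackets with an eventual identity and with its inverse\<close>

lemma FE [simp]: "F \<odot> E = e"
  using mult_comm[of F E] by simp

lemma EF_left [simp]: "X \<in> A \<Longrightarrow> E \<odot> (F \<odot> X) = X" "X \<in> A \<Longrightarrow> F \<odot> (E \<odot> X) = X"
  by (simp_all flip: mult_assoc)

lemma br_skew: "X \<in> A \<Longrightarrow> Y \<in> A \<Longrightarrow> br X Y = - br Y X"
  by (simp add: br_eq)

lemma br_E:
  assumes "X \<in> A" "Y \<in> A"
  shows "br E (X \<odot> Y) = br E X \<odot> Y + X \<odot> br E Y + br e E \<odot> (X \<odot> Y)"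
proof -
  \<comment> \<open>Putting \<open>E \<odot> U\<close> for the first factor in
    \<open>br_E_dual\<close> absorbs \<open>F\<close>. The choice \<open>W = e\<close> then
    evaluates the unknown \<open>F \<odot> br E (E \<odot> U)\<close>.\<close>
  have *: "br E (U \<odot> W) = F \<odot> br E (E \<odot> U) \<odot> W + U \<odot> br E W" if "U \<in> A" "W \<in> A" for U W
    using br_E_dual[of "E \<odot> U" W] that by (simp add: ac)
  have "F \<odot> br E (E \<odot> X) = br E X - X \<odot> br E e"
    using *[OF assms(1) unit_closed] assms by simp
  then show ?thesis
    using *[OF assms] assms br_skew[of e E] by (simp add: distribs ac)
qed

text \<open>The F-manifold identity for \<open>E \<odot> F = e\<close> relates the Lie derivatives
  of the product along \<open>E\<close> and \<open>F\<close>, since the one along \<open>e\<close>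
  vanishes. With \<open>br_E\<close> it determines the one along \<open>F\<close>, and deriving
  \<open>E \<odot> F = e\<close> along \<open>e\<close> expresses the result by
  \<open>br e F\<close>.\<close>

lemma br_F:
  assumes "X \<in> A" "Y \<in> A"
  shows "br F (X \<odot> Y) = br F X \<odot> Y + X \<odot> br F Y + br e F \<odot> (X \<odot> Y)"
proof -
  have "br e e = 0" by (simp add: br_eq)
  then have "E \<odot> br e F = - (F \<odot> br e E)"
    using br_unit[of E F] by (simp add: ac add_eq_0_iff)
  moreover define P where "P = br F (X \<odot> Y) - br F X \<odot> Y - X \<odot> br F Y"
  moreover have "0 = E \<odot> P + F \<odot> (br e E \<odot> (X \<odot> Y))"
    using lie_mult[of E F X Y] br_E[OF assms] br_unit[OF assms] assms by (simp add: P_def)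
  ultimately have eF: "E \<odot> br e F = - (F \<odot> br e E)"
    and 0: "E \<odot> P = - (F \<odot> (br e E \<odot> (X \<odot> Y)))"
    by (simp_all add: eq_neg_iff_add_eq_0)
  have "E \<odot> (br e F \<odot> (X \<odot> Y)) = (E \<odot> br e F) \<odot> (X \<odot> Y)"
    using assms by (simp add: mult_assoc)
  also have "\<dots> = E \<odot> P"
    unfolding eF 0 using assms by (simp add: minus_mult_left mult_assoc)
  finally have "E \<odot> P = E \<odot> (br e F \<odot> (X \<odot> Y))" by simp
  then have "F \<odot> (E \<odot> P) = F \<odot> (E \<odot> (br e F \<odot> (X \<odot> Y)))" by simp
  then have "P = br e F \<odot> (X \<odot> Y)"
    using assms by (simp add: P_def)
  then show ?thesis by (simp add: P_def algebra_simps)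
qed

section \<open>Torsion of the dual connection\<close>

definition dual_D :: "'v \<Rightarrow> 'v \<Rightarrow> 'v"
  where "dual_D X Y = E \<odot> D X (F \<odot> Y) - D (F \<odot> Y) E \<odot> X"

text \<open>\<open>D (E \<odot> x) F\<close> is \<open>D F (E \<odot> x)\<close> minus a bracket.
  Compatibility expands the former and \<open>br_F\<close> the latter; the terms with
  \<open>br F x\<close> cancel, and what remains besides \<open>F \<odot> D x E\<close> is a
  multiple of \<open>x\<close>.\<close>

lemma dual_D_torsion_key:
  assumes "x \<in> A"
  shows "E \<odot> D (E \<odot> x) F + D x E = E \<odot> x \<odot> (D E F - E \<odot> br e F + D e e)"
proof -
  have "D F (E \<odot> x) = D F (x \<odot> E)"
    using assms by (simp add: ac)
  also have "\<dots> = D x (F \<odot> E) + br F x \<odot> E + x \<odot> D F E - F \<odot> D x E"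
    using assms by (intro D_mult_swap) auto
  finally have a: "D F (E \<odot> x) = x \<odot> D e e + br F x \<odot> E + x \<odot> D F E - F \<odot> D x E"
    using assms D_unit[of x] by simp
  have b: "br F (E \<odot> x) = br F E \<odot> x + E \<odot> br F x + br e F \<odot> (E \<odot> x)"
    using br_F[of E x] assms by simp
  have c: "D (E \<odot> x) F = D F (E \<odot> x) - br F (E \<odot> x)" and d: "br F E = D F E - D E F"
    using assms by (simp_all add: br_eq)
  have 1: "br F x \<in> A" "br e F \<in> A" "br F E \<in> A" using assms by simp_all
  have "D (E \<odot> x) F = x \<odot> D e e + x \<odot> D E F - F \<odot> D x E - E \<odot> (br e F \<odot> x)"
    unfolding c a b using assms 1 by (simp add: d distribs ac)
  then show ?thesis
    using assms 1 by (simp add: distribs ac)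
qed

text \<open>The key identity at \<open>F \<odot> U\<close> trades \<open>D (F \<odot> U) E\<close>
  for \<open>D U F\<close> plus \<open>U \<odot> K\<close> with a fixed \<open>K\<close>. The terms
  in \<open>X \<odot> Y \<odot> K\<close> cancel by symmetry, those in \<open>D X F\<close> and
  \<open>D Y F\<close> against the ones produced by \<open>D_mult_swap\<close>.\<close>

lemma dual_D_torsion:
  assumes "X \<in> A" "Y \<in> A"
  shows "dual_D X Y - dual_D Y X = br X Y"
proof -
  define K where "K = D E F - E \<odot> br e F + D e e"
  have K: "K \<in> A" by (simp add: K_def)
  have key: "D (F \<odot> U) E = U \<odot> K - E \<odot> D U F" if "U \<in> A" for U
    using dual_D_torsion_key[of "F \<odot> U"] that by (simp add: K_def algebra_simps)
  have "D X (F \<odot> Y) = D Y (F \<odot> X) + br X Y \<odot> F + Y \<odot> D X F - X \<odot> D Y F"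
    using D_mult_swap[of X Y F] assms by (simp add: mult_comm[of F])
  then have "dual_D X Y - dual_D Y X =
      E \<odot> (br X Y \<odot> F) + E \<odot> (Y \<odot> D X F) - E \<odot> (X \<odot> D Y F)
      - D (F \<odot> Y) E \<odot> X + D (F \<odot> X) E \<odot> Y"
    using assms by (simp add: dual_D_def distribs)
  also have "\<dots> = br X Y"
  proof -
    have "E \<odot> (br X Y \<odot> F) = br X Y"
      using assms by (simp add: ac)
    then show ?thesis
      using assms K by (simp add: key distribs ac)
  qed
  finally show ?thesis .
qed

text \<open>\<open>dual_C X Y Z\<close> is \<open>\<nabla>\<^sub>X(*)(Y, Z)\<close> for the dual connection \<open>\<nabla>\<close> and the dual product \<open>*\<close>.\<close>

definition dual_C :: "'v \<Rightarrow> 'v \<Rightarrow> 'v \<Rightarrow> 'v"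
  where "dual_C X Y Z = dual_D X (Y \<odot> Z \<odot> F) - dual_D X Y \<odot> Z \<odot> F - Y \<odot> dual_D X Z \<odot> F"

section \<open>Compatibility of the dual connection with the dual product\<close>

lemma dual_C_sym_right: "X \<in> A \<Longrightarrow> Y \<in> A \<Longrightarrow> Z \<in> A \<Longrightarrow> dual_C X Y Z = dual_C X Z Y"
  by (simp add: dual_C_def dual_D_def distribs ac)

text \<open>Arguments of the form \<open>E \<odot> x\<close> make all factors \<open>F\<close>
  disappear. The right-hand side is arranged so that its asymmetry in \<open>x\<close> and
  \<open>y\<close> sits only in terms that differentiate along \<open>E\<close> or differentiate
  \<open>E\<close>.\<close>

lemma dual_C_scaled:
  assumes "x \<in> A" "y \<in> A" "z \<in> A"
  shows "dual_C (E \<odot> x) (E \<odot> y) (E \<odot> z) =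
    E \<odot> (D z (E \<odot> x \<odot> y) - D z E \<odot> x \<odot> y - E \<odot> y \<odot> D z x - E \<odot> x \<odot> D z y
      - y \<odot> D E (x \<odot> z) + y \<odot> z \<odot> D E x + x \<odot> y \<odot> D E z
      - x \<odot> D (y \<odot> z) E + x \<odot> z \<odot> D y E + x \<odot> y \<odot> D z E)"
proof -
  have r: "E \<odot> y \<odot> (E \<odot> z) \<odot> F = E \<odot> (y \<odot> z)" using assms by (simp add: ac)
  have 1: "dual_C (E \<odot> x) (E \<odot> y) (E \<odot> z) =
      E \<odot> (D (E \<odot> x) (y \<odot> z) - D (E \<odot> x) y \<odot> z - y \<odot> D (E \<odot> x) z
        - x \<odot> (D (y \<odot> z) E - z \<odot> D y E - y \<odot> D z E))"
    using assms by (simp add: dual_C_def dual_D_def r) (simp add: distribs ac)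
  \<comment> \<open>Differentiation along \<open>E \<odot> x\<close> becomes differentiation along
    \<open>z\<close>. The term \<open>D z (E \<odot> x \<odot> y)\<close> is kept, being symmetric
    in \<open>x\<close> and \<open>y\<close>; a second exchange splits
    \<open>D z (E \<odot> x)\<close>.\<close>
  have 2: "D (E \<odot> x) (y \<odot> z) - D (E \<odot> x) y \<odot> z - y \<odot> D (E \<odot> x) z =
      D z (E \<odot> x \<odot> y) - D z (E \<odot> x) \<odot> y - E \<odot> x \<odot> D z y"
    using compat_swap[of "E \<odot> x" z y] assms by (simp add: ac algebra_simps)
  have 3: "D z (E \<odot> x) = D E (x \<odot> z) - D E x \<odot> z - x \<odot> D E z + D z E \<odot> x + E \<odot> D z x"
    using compat_swap[of z E x] assms by (simp add: ac algebra_simps)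
  show ?thesis
    unfolding 1 2 3 using assms by (simp add: distribs ac)
qed

text \<open>Torsion-freeness rewrites derivatives of \<open>E\<close> as derivatives along
  \<open>E\<close> minus brackets, and \<open>br_E\<close> expands the bracket with a product. The
  remaining expression is symmetric in \<open>x\<close> and \<open>y\<close>.\<close>

lemma dual_C_sym_left:
  assumes "X \<in> A" "Y \<in> A" "Z \<in> A"
  shows "dual_C X Y Z = dual_C Y X Z"
proof -
  define x y z where "x = F \<odot> X" "y = F \<odot> Y" "z = F \<odot> Z"
  have A: "x \<in> A" "y \<in> A" "z \<in> A" using assms by (simp_all add: x_y_z_def)
  have eq: "X = E \<odot> x" "Y = E \<odot> y" "Z = E \<odot> z" using assms by (simp_all add: x_y_z_def)
  have D1: "D (a \<odot> z) E = D E (a \<odot> z) - br E a \<odot> z - a \<odot> br E z - br e E \<odot> (a \<odot> z)"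
    if "a \<in> A" for a
    using br_E[of a z] br_eq[of E "a \<odot> z"] that A by (simp add: algebra_simps)
  have D2: "D a E = D E a - br E a" if "a \<in> A" for a
    using br_eq[of E a] that by simp
  show ?thesis
    unfolding eq dual_C_scaled[OF A] dual_C_scaled[OF A(2,1,3)]
    using A by (simp add: D1 D2[of x] D2[of y] distribs ac)
qed

end

section \<open>Products of vector fields\<close>

lemma tangent_multD:
  assumes "tangent_mult M m" "p \<in> points M" "u \<in> tangent_space M p" "v \<in> tangent_space M p"
  shows "m p u v \<in> tangent_space M p" "m p u v = m p v u"
    "m p (tscale c u) v = tscale c (m p u v)" "m p u (tscale c v) = tscale c (m p u v)"
    "w \<in> tangent_space M p \<Longrightarrow> m p (u + v) w = m p u w + m p v w"
    "w \<in> tangent_space M p \<Longrightarrow> m p (m p u v) w = m p u (m p v w)"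
proof -
  note tm = assms(1)[unfolded tangent_mult_def]
  show "m p u v \<in> tangent_space M p"
    using tm[THEN conjunct1, THEN PiE_mem, OF assms(2), THEN PiE_mem, OF assms(3), THEN PiE_mem, OF assms(4)] .
  note * = tm[THEN conjunct2, THEN conjunct1, THEN bspec, OF assms(2), THEN bspec, OF assms(3),
      THEN bspec, OF assms(4)]
  show "m p u v = m p v u" "m p (tscale c u) v = tscale c (m p u v)"
    "m p u (tscale c v) = tscale c (m p u v)"
    using * by blast+
  show "m p (u + v) w = m p u w + m p v w" "m p (m p u v) w = m p u (m p v w)"
    if "w \<in> tangent_space M p"
    using * that by blast+
qed

lemma F_manifoldD:
  assumes "F_manifold M m e"
  shows "smooth_manifold M" "tangent_mult M m" "e \<in> vfields M"
    "p \<in> points M \<Longrightarrow> u \<in> tangent_space M p \<Longrightarrow> m p (e p) u = u"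
  using assms by (auto simp: F_manifold_def is_unit_field_def)

lemma vprod_closed:
  "tangent_mult M m \<Longrightarrow> X \<in> vfields M \<Longrightarrow> Y \<in> vfields M \<Longrightarrow> vprod M m X Y \<in> vfields M"
  by (simp add: tangent_mult_def)

lemma vprod_vscale:
  assumes "tangent_mult M m" "X \<in> vfields M" "Y \<in> vfields M"
  shows "vprod M m (vscale f X) Y = vscale f (vprod M m X Y)"
    and "vprod M m X (vscale f Y) = vscale f (vprod M m X Y)"
proof -
  \<comment> \<open>Off \<open>points M\<close> products have the default value 0, which scaling has
    to preserve.\<close>
  have "tscale c 0 = 0" for c by (simp add: tscale_def fun_eq_iff)
  then show "vprod M m (vscale f X) Y = vscale f (vprod M m X Y)"
      "vprod M m X (vscale f Y) = vscale f (vprod M m X Y)"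
    using assms(2,3)
    by (auto simp: vprod_def vscale_def vfields_tangent intro!: ext[where 'a='a]
        tangent_multD(3,4)[OF assms(1)])
qed

section \<open>Vector fields of an F-manifold as an abstract algebra\<close>

lemma carrier_algebra_vprod:
  assumes "F_manifold M m e"
  shows "carrier_algebra (vfields M) (vprod M m) e"
proof
  note F = F_manifoldD[OF assms]
  note tm = tangent_multD[OF F(2)]
  show "e \<in> vfields M" by (rule F(3))
  show "X + Y \<in> vfields M" if "X \<in> vfields M" "Y \<in> vfields M" for X Y
    using that F(1) by (rule vfields_add[rotated])
  show "- X \<in> vfields M" if "X \<in> vfields M" for X
    using that F(1) by (rule vfields_uminus[rotated])
  show "vprod M m X Y \<in> vfields M" if "X \<in> vfields M" "Y \<in> vfields M" for X Y
    using that F(2) by (rule vprod_closed[rotated])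
  show "vprod M m X Y = vprod M m Y X" if "X \<in> vfields M" "Y \<in> vfields M" for X Y
    using that by (auto simp: vprod_def vfields_tangent intro!: ext[where 'a='a] tm(2))
  show "vprod M m (vprod M m X Y) Z = vprod M m X (vprod M m Y Z)"
    if "X \<in> vfields M" "Y \<in> vfields M" "Z \<in> vfields M" for X Y Z
    using that by (auto simp: vprod_def vfields_tangent tm(1) intro!: ext[where 'a='a] tm(6))
  show "vprod M m (X + Y) Z = vprod M m X Z + vprod M m Y Z"
    if "X \<in> vfields M" "Y \<in> vfields M" "Z \<in> vfields M" for X Y Z
    using that by (auto simp: fun_eq_iff[where 'a='a] vprod_def vfields_tangent tm(5))
  \<comment> \<open>Off \<open>points M\<close> the product is 0 by definition, and so is
    \<open>X\<close>.\<close>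
  show "vprod M m e X = X" if "X \<in> vfields M" for X
    using that by (auto simp: fun_eq_iff[where 'a='a] vprod_def vfields_tangent F(4) vfields_off)
qed

lemma compatible_algebra_vprod:
  assumes "F_manifold M m e" "connection M D" "torsion_free M D" "compatible M m D"
  shows "compatible_algebra (vfields M) (vprod M m) e lie_bracket D"
proof -
  interpret carrier_algebra "vfields M" "vprod M m" e
    by (rule carrier_algebra_vprod) fact
  show ?thesis
  proof
    show "D X (vprod M m Y Z) - vprod M m (D X Y) Z - vprod M m Y (D X Z) =
        D Y (vprod M m X Z) - vprod M m (D Y X) Z - vprod M m X (D Y Z)"
      if "X \<in> vfields M" "Y \<in> vfields M" "Z \<in> vfields M" for X Y Z
      using that assms(4) by (simp add: compatible_def conn_mult_def)
    show "lie_bracket X Y = D X Y - D Y X" if "X \<in> vfields M" "Y \<in> vfields M" for X Y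
      using that assms(3) by (simp add: torsion_free_def)
  qed (use assms(2) in \<open>auto simp: connection_def PiE_iff\<close>)
qed

lemma curvature_condition_iff:
  "curvature_condition M m D \<longleftrightarrow>
    (\<forall>X\<in>vfields M. \<forall>Y\<in>vfields M. \<forall>Z\<in>vfields M. \<forall>V\<in>vfields M.
      cyclic_sum (vprod M m) (curv lie_bracket D) X Y Z V = 0)"
  by (simp add: curvature_condition_def cyclic_sum_def curv_def curvature_def)

text \<open>Since \<open>e\<close> is idempotent, the F-manifold identity reads
  \<open>L = L + L\<close> for the Lie derivative \<open>L\<close> of the product along
  \<open>e\<close>, so \<open>L = 0\<close>. Closure under brackets is supplied later by a
  torsion-free connection.\<close>

lemma lie_bracket_unit:
  assumes "F_manifold M m e"
    and br: "\<And>X Y. X \<in> vfields M \<Longrightarrow> Y \<in> vfields M \<Longrightarrow> lie_bracket X Y \<in> vfields M"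
    and A: "X \<in> vfields M" "Y \<in> vfields M"
  shows "lie_bracket e (vprod M m X Y) =
    vprod M m (lie_bracket e X) Y + vprod M m X (lie_bracket e Y)"
proof -
  interpret carrier_algebra "vfields M" "vprod M m" e
    by (rule carrier_algebra_vprod) fact
  have "lie_mult M m e X Y = lie_mult M m (vprod M m e e) X Y" by simp
  also have "\<dots> = vprod M m e (lie_mult M m e X Y) + vprod M m e (lie_mult M m e X Y)"
    using assms(1) A unit_closed unfolding F_manifold_def by blast
  also have "\<dots> = lie_mult M m e X Y + lie_mult M m e X Y"
    using A br by (simp add: lie_mult_def)
  finally show ?thesis
    by (simp add: lie_mult_def algebra_simps)
qed

section \<open>Inverse fields and the dual product\<close>

lemma inv_field_eqI:
  assumes "F_manifold M m e" "E \<in> vfields M" "Y \<in> vfields M" "vprod M m E Y = e"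
  shows "inv_field M m e E = Y"
proof -
  interpret carrier_algebra "vfields M" "vprod M m" e
    by (rule carrier_algebra_vprod) fact
  show ?thesis
    unfolding inv_field_def
  proof (rule the_equality)
    fix Y' assume Y': "Y' \<in> vfields M \<and> vprod M m E Y' = e"
    have "Y' = vprod M m (vprod M m E Y) Y'" using Y' by (simp add: assms(4))
    also have "\<dots> = vprod M m Y (vprod M m E Y')"
      using Y'[THEN conjunct1] assms(2,3) by (simp add: ac)
    also have "\<dots> = Y" using Y' assms by simp
    finally show "Y' = Y" .
  qed (use assms in auto)
qed

lemma inv_fieldD:
  assumes "F_manifold M m e" "invertible_field M m e E"
  shows "E \<in> vfields M" "inv_field M m e E \<in> vfields M" "vprod M m E (inv_field M m e E) = e"
  using assms inv_field_eqI[OF assms(1)] by (auto simp: invertible_field_def)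

lemma vprod_dual_mult:
  assumes "F_manifold M m e" "X \<in> vfields M" "Y \<in> vfields M"
  shows "vprod M (dual_mult M m e E) X Y = vprod M m (vprod M m X Y) (inv_field M m e E)"
  using assms by (auto simp: vprod_def dual_mult_def vfields_tangent)

lemma eventual_algebra_vprod:
  assumes F: "F_manifold M m e" and D: "connection M D" "torsion_free M D" "compatible M m D"
    and E: "eventual_identity M m e E"
  shows "eventual_algebra (vfields M) (vprod M m) e lie_bracket D E (inv_field M m e E)"
proof -
  interpret compatible_algebra "vfields M" "vprod M m" e lie_bracket D
    by (rule compatible_algebra_vprod) fact+
  have F': "F_manifold M (dual_mult M m e E) E" and E': "invertible_field M m e E"
    using E by (auto simp: eventual_identity_def)
  note inv = inv_fieldD[OF F E']
  show ?thesis
  proof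
    show "lie_bracket e (vprod M m X Y) =
        vprod M m (lie_bracket e X) Y + vprod M m X (lie_bracket e Y)"
      if "X \<in> vfields M" "Y \<in> vfields M" for X Y
      using that F by (intro lie_bracket_unit) auto
    \<comment> \<open>The preceding fact about units, applied to the dual F-manifold and written out
      in the original product.\<close>
    show "lie_bracket E (vprod M m (vprod M m X Y) (inv_field M m e E)) =
        vprod M m (vprod M m (lie_bracket E X) Y) (inv_field M m e E) +
        vprod M m (vprod M m X (lie_bracket E Y)) (inv_field M m e E)"
      if "X \<in> vfields M" "Y \<in> vfields M" for X Y
      using that lie_bracket_unit[OF F' br_closed that] inv
      by (simp add: vprod_dual_mult[OF F])
    show "lie_bracket (vprod M m X Y) (vprod M m Z W) - vprod M m (lie_bracket (vprod M m X Y) Z) W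
        - vprod M m Z (lie_bracket (vprod M m X Y) W) =
      vprod M m X (lie_bracket Y (vprod M m Z W) - vprod M m (lie_bracket Y Z) W
        - vprod M m Z (lie_bracket Y W)) +
      vprod M m Y (lie_bracket X (vprod M m Z W) - vprod M m (lie_bracket X Z) W
        - vprod M m Z (lie_bracket X W))"
      if "X \<in> vfields M" "Y \<in> vfields M" "Z \<in> vfields M" "W \<in> vfields M" for X Y Z W
      using F that unfolding F_manifold_def lie_mult_def by blast
  qed (use inv in auto)
qed

section \<open>The dual structure\<close>

lemma PiE_ext3:
  assumes "m \<in> (\<Pi>\<^sub>E p\<in>P. S p \<rightarrow>\<^sub>E S p \<rightarrow>\<^sub>E S p)" "m' \<in> (\<Pi>\<^sub>E p\<in>P. S p \<rightarrow>\<^sub>E S p \<rightarrow>\<^sub>E S p)"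
    and "\<And>p u v. p \<in> P \<Longrightarrow> u \<in> S p \<Longrightarrow> v \<in> S p \<Longrightarrow> m p u v = m' p u v"
  shows "m = m'"
proof (rule PiE_ext[OF assms(1,2)])
  fix p assume p: "p \<in> P"
  note mp = assms(1,2)[THEN PiE_mem, OF p]
  show "m p = m' p"
  proof (rule PiE_ext[OF mp])
    fix u assume u: "u \<in> S p"
    show "m p u = m' p u"
      by (rule PiE_ext[OF mp[THEN PiE_mem, OF u]]) (rule assms(3)[OF p u])
  qed
qed

text \<open>The inverse of \<open>e\<close> for the dual product is \<open>E \<circ> E\<close>,
  because \<open>e * (E \<circ> E) = E \<circ> E \<circ> E\<^sup>-\<^sup>1 = E\<close>. Dualising
  twice therefore multiplies by \<open>E\<close> twice and by its inverse twice.\<close>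

lemma
  assumes F: "F_manifold M m e" and E: "eventual_identity M m e E"
  shows dual_mult_involutive: "dual_mult M (dual_mult M m e E) E e = m"
    and eventual_identity_dual: "eventual_identity M (dual_mult M m e E) E e"
proof -
  define m' F' where "m' = dual_mult M m e E" and "F' = inv_field M m e E"
  have F2: "F_manifold M m' E" and E': "invertible_field M m e E"
    using E by (auto simp: eventual_identity_def m'_def)
  note inv = inv_fieldD[OF F E', folded F'_def]
  note vp = vprod_dual_mult[OF F, of _ _ E, folded m'_def F'_def]
  interpret carrier_algebra "vfields M" "vprod M m" e
    by (rule carrier_algebra_vprod) fact
  have EE: "vprod M m' e (vprod M m E E) = E"
    using inv by (simp add: vp mult_assoc)
  have inv2: "inv_field M m' E e = vprod M m E E"
    using inv EE by (intro inv_field_eqI[OF F2]) auto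
  \<comment> \<open>Here \<open>u\<close> and \<open>v\<close> are arbitrary tangent vectors rather
    than values of given fields, so the cancellation is carried out in the tangent space at
    \<open>p\<close>.\<close>
  have m2: "dual_mult M m' E e p u v = m p u v"
    if p: "p \<in> points M" "u \<in> tangent_space M p" "v \<in> tangent_space M p" for p u v
  proof -
    note tm = tangent_multD[OF F_manifoldD(2)[OF F] p(1)]
    define a b where "a = E p" and "b = F' p"
    have ab: "a \<in> tangent_space M p" "b \<in> tangent_space M p"
      unfolding a_def b_def using inv p by (auto intro: vfields_tangent)
    have eab: "e p = m p a b"
      unfolding inv(3)[symmetric] using p by (simp add: vprod_def a_def b_def)
    have unit: "m p (m p a b) w = w" if "w \<in> tangent_space M p" for w
      using F_manifoldD(4)[OF F p(1) that] eab by simp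
    define w where "w = m p u v"
    have w: "w \<in> tangent_space M p" unfolding w_def using p by (intro tm(1))
    have "dual_mult M m' E e p u v = m p (m p (m p w b) (m p a a)) b"
    proof -
      have m': "m' p x y = m p (m p x y) b" if "x \<in> tangent_space M p" "y \<in> tangent_space M p" for x y
        using p that by (simp add: m'_def dual_mult_def F'_def b_def)
      have "dual_mult M m' E e p u v = m' p (m' p u v) (m p a a)"
        using p by (simp add: dual_mult_def inv2 vprod_def a_def)
      then show ?thesis using p ab w by (simp add: m' w_def tm(1))
    qed
    also have "\<dots> = m p (m p w b) (m p (m p a a) b)"
      using w ab by (intro tm(6)) (auto intro: tm(1))
    also have "m p (m p a a) b = m p (m p a b) a"
      using ab by (simp add: tm(6) tm(2)[of b a])
    also have "m p (m p a b) a = a" by (rule unit) fact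
    also have "m p (m p w b) a = m p (m p a b) w"
      using tm(6)[OF w ab(2,1)] tm(2)[OF w tm(1)[OF ab(2,1)]] tm(2)[OF ab(2,1)] by simp
    also have "\<dots> = m p u v"
      unfolding w_def[symmetric] by (rule unit) fact
    finally show ?thesis .
  qed
  have cl: "dual_mult M m' E e \<in>
      (\<Pi>\<^sub>E p\<in>points M. tangent_space M p \<rightarrow>\<^sub>E tangent_space M p \<rightarrow>\<^sub>E tangent_space M p)"
    using m2 tangent_multD(1)[OF F_manifoldD(2)[OF F]] by (auto simp: dual_mult_def PiE_iff)
  show *: "dual_mult M (dual_mult M m e E) E e = m"
    unfolding m'_def[symmetric]
    using cl m2 F_manifoldD(2)[OF F] by (intro PiE_ext3) (auto simp: tangent_mult_def)
  show "eventual_identity M (dual_mult M m e E) E e"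
    using inv EE F * by (auto simp: eventual_identity_def invertible_field_def m'_def[symmetric])
qed

section \<open>Special families and their duals\<close>

lemma shift_conn_apply:
  "X \<in> vfields M \<Longrightarrow> Y \<in> vfields M \<Longrightarrow>
    shift_conn M m D V X Y = D X Y + vprod M m (vprod M m V X) Y"
  by (simp add: shift_conn_def)

lemma curvature_condition_shift:
  assumes "F_manifold M m e" "connection M D" "torsion_free M D" "compatible M m D" "V \<in> vfields M"
  shows "curvature_condition M m (shift_conn M m D V) \<longleftrightarrow> curvature_condition M m D"
proof -
  interpret compatible_algebra "vfields M" "vprod M m" e lie_bracket D
    by (rule compatible_algebra_vprod) fact+
  show ?thesis
    unfolding curvature_condition_iff
    by (rule cyclic_sum_perturbed_iff[of e e "vprod M m V"])
      (use assms(5) in \<open>auto simp: shift_conn_apply distribs ac\<close>)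
qed

text \<open>The shift contributes \<open>V \<circ> X \<circ> Y\<close> to each of the first two
  terms of the dual connection, with opposite signs.\<close>

lemma dual_conn_shift:
  assumes F: "F_manifold M m e" and D: "connection M D" "torsion_free M D" "compatible M m D"
    and E: "eventual_identity M m e E" and V: "V \<in> vfields M"
  shows "dual_conn M m e E (shift_conn M m D V) W = dual_conn M m e E D W"
proof -
  interpret eventual_algebra "vfields M" "vprod M m" e lie_bracket D E "inv_field M m e E"
    by (rule eventual_algebra_vprod) fact+
  have "vprod M m E (shift_conn M m D V X (vprod M m (inv_field M m e E) Y))
      - vprod M m (shift_conn M m D V (vprod M m (inv_field M m e E) Y) E) X =
      vprod M m E (D X (vprod M m (inv_field M m e E) Y))
      - vprod M m (D (vprod M m (inv_field M m e E) Y) E) X"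
    if "X \<in> vfields M" "Y \<in> vfields M" for X Y
    using that V by (simp add: shift_conn_apply distribs ac)
  then show ?thesis
    unfolding dual_conn_def Let_def by (intro restrict_ext) simp
qed

lemma
  assumes F: "F_manifold M m e" and D: "connection M D" "torsion_free M D" "compatible M m D"
    and E: "eventual_identity M m e E"
  shows curvature_condition_dual_conn: "W \<in> vfields M \<Longrightarrow>
      curvature_condition M (dual_mult M m e E) (dual_conn M m e E D W) \<longleftrightarrow> curvature_condition M m D"
    and dual_conn_eq_shift: "W \<in> vfields M \<Longrightarrow> dual_conn M m e E D W =
      shift_conn M (dual_mult M m e E) (dual_conn M m e E D 0) W"
    and connection_dual_conn: "connection M (dual_conn M m e E D 0)"
    and torsion_free_dual_conn: "torsion_free M (dual_conn M m e E D 0)"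
    and compatible_dual_conn: "compatible M (dual_mult M m e E) (dual_conn M m e E D 0)"
proof -
  define I where "I = inv_field M m e E"
  interpret eventual_algebra "vfields M" "vprod M m" e lie_bracket D E I
    unfolding I_def by (rule eventual_algebra_vprod) fact+
  note vp = vprod_dual_mult[OF F, of _ _ E, folded I_def]
  note tm = F_manifoldD(2)[OF F] and sm = F_manifoldD(1)[OF F]
  have dc: "dual_conn M m e E D W X Y = dual_D X Y + vprod M m (vprod M m (vprod M m (vprod M m W X) I) Y) I"
    if "W \<in> vfields M" "X \<in> vfields M" "Y \<in> vfields M" for W X Y
    using that by (simp add: dual_conn_def Let_def I_def[symmetric] vp dual_D_def)
  have dc0: "dual_conn M m e E D 0 X Y = dual_D X Y" if "X \<in> vfields M" "Y \<in> vfields M" for X Y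
    using that by (simp add: dc)
  have dD: "dual_D X Y \<in> vfields M" if "X \<in> vfields M" "Y \<in> vfields M" for X Y
    using that by (simp add: dual_D_def)
  show "dual_conn M m e E D W = shift_conn M (dual_mult M m e E) (dual_conn M m e E D 0) W"
    (is "?L = ?R") if "W \<in> vfields M"
  proof (intro ext[of ?L] ext[of "?L X" for X])
    fix X Y
    have "?L X Y = ?R X Y" if "X \<in> vfields M" "Y \<in> vfields M"
      using that \<open>W \<in> vfields M\<close> by (simp add: dc[of W] dc0 shift_conn_def vp)
    \<comment> \<open>Outside the vector fields both sides take the value
      \<open>undefined\<close>.\<close>
    moreover have "?L X = ?R X" if "X \<notin> vfields M"
      using that by (simp add: dual_conn_def Let_def shift_conn_def)
    moreover have "?L X Y = ?R X Y" if "X \<in> vfields M" "Y \<notin> vfields M"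
      using that by (simp add: dual_conn_def Let_def shift_conn_def)
    ultimately show "?L X Y = ?R X Y" by metis
  qed
  show "curvature_condition M (dual_mult M m e E) (dual_conn M m e E D W) \<longleftrightarrow> curvature_condition M m D"
    if W: "W \<in> vfields M"
  proof -
    let ?D = "dual_conn M m e E D W"
    let ?T = "\<lambda>y. vprod M m (vprod M m W (vprod M m I I)) y - vprod M m I (D y E)"
    \<comment> \<open>Each dual product carries a factor \<open>I\<close>, so the cyclic sum for the
      dual product is \<open>I\<close> times the one for the original product. As \<open>I\<close>
      is invertible, the two vanish together.\<close>
    have "curvature_condition M (dual_mult M m e E) ?D \<longleftrightarrow>
      (\<forall>X\<in>vfields M. \<forall>Y\<in>vfields M. \<forall>Z\<in>vfields M. \<forall>V\<in>vfields M.
         vprod M m I (cyclic_sum (vprod M m) (curv lie_bracket ?D) X Y Z V) = 0)"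
      unfolding curvature_condition_iff
    proof (intro ball_cong refl)
      fix X Y Z V assume A: "X \<in> vfields M" "Y \<in> vfields M" "Z \<in> vfields M" "V \<in> vfields M"
      have c: "curv lie_bracket ?D P Q X \<in> vfields M" if "P \<in> vfields M" "Q \<in> vfields M" for P Q
        using that A W by (simp add: curv_def dc dD)
      show "cyclic_sum (vprod M (dual_mult M m e E)) (curv lie_bracket ?D) X Y Z V = 0 \<longleftrightarrow>
         vprod M m I (cyclic_sum (vprod M m) (curv lie_bracket ?D) X Y Z V) = 0"
        using A c by (simp add: cyclic_sum_def vp distribs ac)
    qed
    also have "\<dots> \<longleftrightarrow> curvature_condition M m ?D"
      unfolding curvature_condition_iff
    proof (intro ball_cong refl)
      fix X Y Z V assume A: "X \<in> vfields M" "Y \<in> vfields M" "Z \<in> vfields M" "V \<in> vfields M"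
      have c: "cyclic_sum (vprod M m) (curv lie_bracket ?D) X Y Z V \<in> vfields M"
        using A W by (simp add: cyclic_sum_def curv_def dc dD)
      then show "vprod M m I (cyclic_sum (vprod M m) (curv lie_bracket ?D) X Y Z V) = 0 \<longleftrightarrow>
          cyclic_sum (vprod M m) (curv lie_bracket ?D) X Y Z V = 0"
        by (metis EF_left(1) E_closed F_closed mult_zero_right)
    qed
    also have "\<dots> \<longleftrightarrow> curvature_condition M m D"
      unfolding curvature_condition_iff
    proof (rule cyclic_sum_perturbed_iff[of E I ?T])
      show "?D X Y = vprod M m E (D X (vprod M m I Y) + vprod M m X (?T (vprod M m I Y)))"
        if "X \<in> vfields M" "Y \<in> vfields M" for X Y
        using that W by (simp add: dc dual_D_def distribs ac)
    qed (use W in \<open>auto simp: D_add_left distribs\<close>)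
    finally show ?thesis .
  qed
  show "torsion_free M (dual_conn M m e E D 0)"
    by (simp add: torsion_free_def dc0 dual_D_torsion)
  show "compatible M (dual_mult M m e E) (dual_conn M m e E D 0)"
  proof -
    have "conn_mult M (dual_mult M m e E) (dual_conn M m e E D 0) X Y Z = dual_C X Y Z"
      if "X \<in> vfields M" "Y \<in> vfields M" "Z \<in> vfields M" for X Y Z
      using that by (simp add: conn_mult_def dual_C_def dc0 vp dD)
    then show ?thesis
      using dual_C_sym_left dual_C_sym_right by (simp add: compatible_def)
  qed
  show "connection M (dual_conn M m e E D 0)"
    unfolding connection_def
  proof (intro conjI ballI)
    show "dual_conn M m e E D 0 \<in> vfields M \<rightarrow>\<^sub>E vfields M \<rightarrow>\<^sub>E vfields M"
    proof -
      have "dual_conn M m e E D 0 \<in> extensional (vfields M)"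
        "\<And>X. X \<in> vfields M \<Longrightarrow> dual_conn M m e E D 0 X \<in> extensional (vfields M)"
        by (simp_all add: dual_conn_def Let_def)
      then show ?thesis using dc0 dD by (simp add: PiE_iff)
    qed
  next
    fix X Y Z assume A: "X \<in> vfields M" "Y \<in> vfields M" "Z \<in> vfields M"
    show "dual_conn M m e E D 0 (X + Y) Z = dual_conn M m e E D 0 X Z + dual_conn M m e E D 0 Y Z"
      "dual_conn M m e E D 0 X (Y + Z) = dual_conn M m e E D 0 X Y + dual_conn M m e E D 0 X Z"
      using A by (simp_all add: dc0 dual_D_def D_add_left D_add_right distribs)
  next
    fix f X Y assume A: "f \<in> smooth_funs M" "X \<in> vfields M" "Y \<in> vfields M"
    have Df: "D (vscale f U) V = vscale f (D U V)"
        "D U (vscale f V) = vscale (vderiv U f) V + vscale f (D U V)"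
      if "U \<in> vfields M" "V \<in> vfields M" for U V
      using D(1) A(1) that by (auto simp: connection_def)
    have df: "vderiv X f \<in> smooth_funs M" using A by (simp add: vfields_def)
    have vs: "vscale g (U - V) = vscale g U - vscale g V" for g :: "'a \<Rightarrow> real" and U V
      by (auto simp: fun_eq_iff vscale_def tscale_def algebra_simps)
    note [simp] = vfields_vscale[OF sm] vprod_vscale[OF tm]
    show "dual_conn M m e E D 0 (vscale f X) Y = vscale f (dual_conn M m e E D 0 X Y)"
      using A by (simp add: dc0 dual_D_def Df vs)
    \<comment> \<open>Only the first term of \<open>dual_D\<close> differentiates \<open>f\<close>,
      and there \<open>E\<close> and \<open>I\<close> cancel. In the second term \<open>Y\<close>
      gives the direction, in which \<open>D\<close> is linear over functions.\<close>
    show "dual_conn M m e E D 0 X (vscale f Y) =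
        vscale (vderiv X f) Y + vscale f (dual_conn M m e E D 0 X Y)"
      using A df by (simp add: dc0 dual_D_def Df vs distribs)
  qed
qed

text \<open>The parameter \<open>V\<close> of the original family drops out, and \<open>W\<close>
  acts as a shift for the dual product.\<close>

lemma dual_family_assoc:
  assumes F: "F_manifold M m e" and D: "connection M D" "torsion_free M D" "compatible M m D"
    and E: "eventual_identity M m e E"
  shows "dual_family M m e E (assoc_family M m D) =
    assoc_family M (dual_mult M m e E) (dual_conn M m e E D 0)"
proof -
  interpret carrier_algebra "vfields M" "vprod M m" e
    by (rule carrier_algebra_vprod) fact
  note shift = dual_conn_shift[OF F D E] dual_conn_eq_shift[OF F D E]
  show ?thesis
  proof (intro equalityI subsetI)
    fix D' assume "D' \<in> dual_family M m e E (assoc_family M m D)"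
    then obtain V W where "V \<in> vfields M" "W \<in> vfields M"
        "D' = dual_conn M m e E (shift_conn M m D V) W"
      by (auto simp: dual_family_def assoc_family_def)
    then have "D' = shift_conn M (dual_mult M m e E) (dual_conn M m e E D 0) W"
      using shift by metis
    with \<open>W \<in> vfields M\<close>
    show "D' \<in> assoc_family M (dual_mult M m e E) (dual_conn M m e E D 0)"
      unfolding assoc_family_def by blast
  next
    fix D' assume "D' \<in> assoc_family M (dual_mult M m e E) (dual_conn M m e E D 0)"
    then obtain W where W: "W \<in> vfields M"
        "D' = shift_conn M (dual_mult M m e E) (dual_conn M m e E D 0) W"
      by (auto simp: assoc_family_def)
    \<comment> \<open>Members of \<open>assoc_family\<close> are given as shifts, so the shift by 0
      serves as the starting connection.\<close>
    then have "D' = dual_conn M m e E (shift_conn M m D 0) W"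
      using shift zero_closed by metis
    moreover have "shift_conn M m D 0 \<in> assoc_family M m D"
      unfolding assoc_family_def using zero_closed by blast
    ultimately show "D' \<in> dual_family M m e E (assoc_family M m D)"
      unfolding dual_family_def using W(1) by blast
  qed
qed

text \<open>Both conditions are equivalent to the one for the base connection \<open>D0\<close>: for
  \<open>D\<close> because it is a shift of it, for \<open>D'\<close> because it is a dual
  connection of it.\<close>

lemma curvature_condition_dual_iff:
  assumes F: "F_manifold M m e" and E: "eventual_identity M m e E" and S: "special_family M m S"
    and "D \<in> S" "D' \<in> dual_family M m e E S"
  shows "curvature_condition M m D \<longleftrightarrow> curvature_condition M (dual_mult M m e E) D'"
proof -
  obtain D0 where D0: "connection M D0" "torsion_free M D0" "compatible M m D0"
    and S: "S = assoc_family M m D0"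
    using S by (auto simp: special_family_def)
  obtain V where V: "V \<in> vfields M" "D = shift_conn M m D0 V"
    using assms(4) by (auto simp: S assoc_family_def)
  obtain V' W where W: "W \<in> vfields M" "V' \<in> vfields M"
      "D' = dual_conn M m e E (shift_conn M m D0 V') W"
    using assms(5) by (auto simp: S dual_family_def assoc_family_def)
  then have D': "D' = dual_conn M m e E D0 W"
    using dual_conn_shift[OF F D0 E] by simp
  show ?thesis
    using curvature_condition_shift[OF F D0 V(1)] curvature_condition_dual_conn[OF F D0 E W(1)]
    by (simp add: V D')
qed

lemma special_family_dual:
  assumes F: "F_manifold M m e" and E: "eventual_identity M m e E" and S: "special_family M m S"
  shows "special_family M (dual_mult M m e E) (dual_family M m e E S)"
proof -
  obtain D where D: "connection M D" "torsion_free M D" "compatible M m D"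
    and S: "S = assoc_family M m D"
    using S by (auto simp: special_family_def)
  then show ?thesis
    using connection_dual_conn[OF F D E] torsion_free_dual_conn[OF F D E]
      compatible_dual_conn[OF F D E] dual_family_assoc[OF F D E]
    unfolding special_family_def by blast
qed

theorem theorem24:
  fixes M :: "('a, 'b::euclidean_space) premanifold"
  assumes "smooth_manifold M"
  shows
    "(\<forall>m e D. F_manifold M m e \<and> connection M D \<and> torsion_free M D \<and> compatible M m D \<and>
        curvature_condition M m D \<longrightarrow>
        (\<forall>D0\<in>assoc_family M m D. curvature_condition M m D0))
     \<and> dual_structure M \<in> curvature_F_structures M \<rightarrow> curvature_F_structures M
     \<and> (\<forall>m e E S. F_manifold M m e \<and> eventual_identity M m e E \<and> special_family M m S \<longrightarrow>
        (\<forall>D\<in>S. \<forall>D'\<in>dual_family M m e E S.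
           curvature_condition M m D \<longleftrightarrow> curvature_condition M (dual_mult M m e E) D'))"
proof (intro conjI)
  show "\<forall>m e D. F_manifold M m e \<and> connection M D \<and> torsion_free M D \<and> compatible M m D \<and>
      curvature_condition M m D \<longrightarrow> (\<forall>D0\<in>assoc_family M m D. curvature_condition M m D0)"
    unfolding assoc_family_def using curvature_condition_shift by blast
  show "\<forall>m e E S. F_manifold M m e \<and> eventual_identity M m e E \<and> special_family M m S \<longrightarrow>
      (\<forall>D\<in>S. \<forall>D'\<in>dual_family M m e E S.
         curvature_condition M m D \<longleftrightarrow> curvature_condition M (dual_mult M m e E) D')"
    using curvature_condition_dual_iff by blast
  show "dual_structure M \<in> curvature_F_structures M \<rightarrow> curvature_F_structures M"
  proof
    fix s assume s: "s \<in> curvature_F_structures M"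
    obtain m e E S where s_eq: "s = (m, e, E, S)" by (cases s)
    have F: "F_manifold M m e" and E: "eventual_identity M m e E" and S: "special_family M m S"
      and c: "\<forall>D\<in>S. curvature_condition M m D"
      using s by (auto simp: s_eq curvature_F_structures_def F_structures_def)
    have "curvature_condition M (dual_mult M m e E) D'" if D': "D' \<in> dual_family M m e E S" for D'
    proof -
      \<comment> \<open>Every member of the dual family is built from a member of \<open>S\<close>,
        and the equivalence holds for any such pair.\<close>
      obtain D where "D \<in> S" using D' unfolding dual_family_def by blast
      then show ?thesis using curvature_condition_dual_iff[OF F E S _ D'] c by blast
    qed
    \<comment> \<open>That the dual product gives an F-manifold is part of \<open>E\<close> being an
      eventual identity.\<close>
    then show "dual_structure M s \<in> curvature_F_structures M"
      using eventual_identity_dual[OF F E] special_family_dual[OF F E S] E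
      by (auto simp: s_eq dual_structure_def curvature_F_structures_def F_structures_def
          eventual_identity_def)
  qed
qed

end
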